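(* Let $k$ be a field, $\mathfrak{g}$ a nonzero Lie algebra over $k$, $E$ a vector space containing $\mathfrak{g}$ as a subspace and $[-,-]$ a Lie algebra structure on $E$ such that $\mathfrak{g}$ is a Lie subalgebra of $(E, [-,-])$. Then there exist a subspace $V$ of $E$ that is a complement of $\mathfrak{g}$ in $E$, a Lie extending structure $\Omega(\mathfrak{g}, V) = (\triangleleft, \triangleright, f, \{-,-\})$ of $\mathfrak{g}$ through $V$, and an isomorphism of Lie algebras $(E, [-,-]) \cong \mathfrak{g} \,\natural\, V$ that stabilizes $\mathfrak{g}$ and co-stabilizes $V$.
   Context: All vector spaces, Lie algebras, linear and bilinear maps are over an arbitrary field $k$. A complement of $\mathfrak{g}$ in $E$ is a subspace $V$ with $E=\mathfrak{g}+V$ and $V\cap\mathfrak{g}=0$. An extending datum of a Lie algebra $\mathfrak{g}$ through a vector space $V$ is a system $\Omega(\mathfrak{g}, V) = (\triangleleft, \triangleright, f, \{-,-\})$ of four bilinear maps $\triangleleft : V \times \mathfrak{g} \to V$, $\triangleright : V \times \mathfrak{g} \to \mathfrak{g}$, $f : V\times V \to \mathfrak{g}$, $\{-,-\} : V\times V \to V$. It is a Lie extending structure if the vector space $\mathfrak{g}\times V$ is a Lie algebra with the bracket $$[(g, x), (h, y)] := \bigl([g, h] + x \triangleright h - y\triangleright g + f(x, y),\ \{x, y\} + x\triangleleft h - y\triangleleft g\bigr);$$ this Lie algebra is then denoted $\mathfrak{g}\,\natural\, V$ and called the unified product. Let $\pi: E\to V$ be the projection along $\mathfrak{g}$ associated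 with $E=\mathfrak{g}+V$, and $q:\mathfrak{g}\,\natural\, V\to V$, $q(g,x):=x$. A linear isomorphism $\varphi:\mathfrak{g}\,\natural\, V\to E$ (equivalently, its inverse) stabilizes $\mathfrak{g}$ if $\varphi(g,0)=g$ for all $g\in\mathfrak{g}$, and co-stabilizes $V$ if $\pi\circ\varphi=q$. *)

theory Defs
  imports "HOL-Analysis.Product_Vector"
begin

text \<open>
  Vector spaces are presented as in the library theory of vector spaces: a scalar multiplication
  \<open>s :: 'k::field \<Rightarrow> 'b::ab_group_add \<Rightarrow> 'b\<close>. Since complements are subspaces, (bi)linear maps and
  Lie brackets are relativised to a carrier set; their values outside it are irrelevant.
\<close>

definition linear_on ::
    "('k \<Rightarrow> 'b \<Rightarrow> 'b) \<Rightarrow> ('k \<Rightarrow> 'c \<Rightarrow> 'c) \<Rightarrow> 'b::ab_group_add set \<Rightarrow> 'c::ab_group_add set \<Rightarrow> ('b \<Rightarrow> 'c) \<Rightarrow> bool"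
  where "linear_on s1 s2 A B f \<longleftrightarrow>
    (\<forall>x\<in>A. f x \<in> B) \<and>
    (\<forall>x\<in>A. \<forall>y\<in>A. f (x + y) = f x + f y) \<and>
    (\<forall>c. \<forall>x\<in>A. f (s1 c x) = s2 c (f x))"

definition bilinear_on ::
    "('k \<Rightarrow> 'b \<Rightarrow> 'b) \<Rightarrow> ('k \<Rightarrow> 'c \<Rightarrow> 'c) \<Rightarrow> ('k \<Rightarrow> 'd \<Rightarrow> 'd) \<Rightarrow>
     'b::ab_group_add set \<Rightarrow> 'c::ab_group_add set \<Rightarrow> 'd::ab_group_add set \<Rightarrow> ('b \<Rightarrow> 'c \<Rightarrow> 'd) \<Rightarrow> bool"
  where "bilinear_on s1 s2 s3 A B C f \<longleftrightarrow>
    (\<forall>x\<in>A. linear_on s2 s3 B C (\<lambda>y. f x y)) \<and>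
    (\<forall>y\<in>B. linear_on s1 s3 A C (\<lambda>x. f x y))"

text \<open>The bracket is alternating rather than merely skew-symmetric, because the field may have
  characteristic 2.\<close>

locale lie_algebra_on = vector_space s
  for s :: "'k::field \<Rightarrow> 'b::ab_group_add \<Rightarrow> 'b" +
  fixes L :: "'b set" and br :: "'b \<Rightarrow> 'b \<Rightarrow> 'b"
  assumes carrier_subspace: "subspace L"
    and bracket_bilinear: "bilinear_on s s s L L L br"
    and bracket_self: "x \<in> L \<Longrightarrow> br x x = 0"
    and jacobi: "x \<in> L \<Longrightarrow> y \<in> L \<Longrightarrow> z \<in> L \<Longrightarrow>
      br x (br y z) + br y (br z x) + br z (br x y) = 0"

definition lie_subalgebra ::
    "('k::field \<Rightarrow> 'b \<Rightarrow> 'b) \<Rightarrow> 'b set \<Rightarrow> ('b \<Rightarrow> 'b \<Rightarrow> 'b) \<Rightarrow>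
     'b::ab_group_add set \<Rightarrow> ('b \<Rightarrow> 'b \<Rightarrow> 'b) \<Rightarrow> bool"
  where "lie_subalgebra s L brL M brM \<longleftrightarrow>
    lie_algebra_on s L brL \<and> lie_algebra_on s M brM \<and> L \<subseteq> M \<and>
    (\<forall>x\<in>L. \<forall>y\<in>L. brL x y = brM x y)"

definition lie_algebra_iso ::
    "('k::field \<Rightarrow> 'b \<Rightarrow> 'b) \<Rightarrow> 'b::ab_group_add set \<Rightarrow> ('b \<Rightarrow> 'b \<Rightarrow> 'b) \<Rightarrow>
     ('k \<Rightarrow> 'c \<Rightarrow> 'c) \<Rightarrow> 'c::ab_group_add set \<Rightarrow> ('c \<Rightarrow> 'c \<Rightarrow> 'c) \<Rightarrow> ('b \<Rightarrow> 'c) \<Rightarrow> bool"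
  where "lie_algebra_iso s1 L1 br1 s2 L2 br2 \<phi> \<longleftrightarrow>
    linear_on s1 s2 L1 L2 \<phi> \<and> bij_betw \<phi> L1 L2 \<and>
    (\<forall>x\<in>L1. \<forall>y\<in>L1. \<phi> (br1 x y) = br2 (\<phi> x) (\<phi> y))"

text \<open>The ambient space is the whole type \<open>'b\<close>.\<close>

definition is_complement ::
    "('k::field \<Rightarrow> 'b \<Rightarrow> 'b) \<Rightarrow> 'b::ab_group_add set \<Rightarrow> 'b set \<Rightarrow> bool"
  where "is_complement s G V \<longleftrightarrow>
    module.subspace s V \<and> {g + v | g v. g \<in> G \<and> v \<in> V} = UNIV \<and> V \<inter> G = {0}"

text \<open>Projection onto \<open>V\<close> along \<open>G\<close>; meaningful only if \<open>V\<close> is a complement of \<open>G\<close>.\<close>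

definition projection_along :: "'b::ab_group_add set \<Rightarrow> 'b set \<Rightarrow> 'b \<Rightarrow> 'b"
  where "projection_along G V e = (THE v. v \<in> V \<and> (\<exists>g\<in>G. e = g + v))"

text \<open>
  In what follows \<open>ract\<close>, \<open>lact\<close>, \<open>f\<close> and \<open>brV\<close> stand for the maps
  \<open>\<triangleleft> : V \<times> \<gg> \<rightarrow> V\<close>, \<open>\<triangleright> : V \<times> \<gg> \<rightarrow> \<gg>\<close>, \<open>f : V \<times> V \<rightarrow> \<gg>\<close> and
  \<open>{-,-} : V \<times> V \<rightarrow> V\<close> of an extending datum; the vector of \<open>V\<close> is the first argument of both actions.
\<close>

locale extending_datum =
  G: lie_algebra_on s1 G brG + V: vector_space s2
  for s1 :: "'k::field \<Rightarrow> 'b::ab_group_add \<Rightarrow> 'b"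
    and G :: "'b set" and brG :: "'b \<Rightarrow> 'b \<Rightarrow> 'b"
    and s2 :: "'k \<Rightarrow> 'c::ab_group_add \<Rightarrow> 'c" +
  fixes V :: "'c set"
    and ract :: "'c \<Rightarrow> 'b \<Rightarrow> 'c"
    and lact :: "'c \<Rightarrow> 'b \<Rightarrow> 'b"
    and f :: "'c \<Rightarrow> 'c \<Rightarrow> 'b"
    and brV :: "'c \<Rightarrow> 'c \<Rightarrow> 'c"
  assumes V_subspace: "V.subspace V"
    and ract_bilinear: "bilinear_on s2 s1 s2 V G V ract"
    and lact_bilinear: "bilinear_on s2 s1 s1 V G G lact"
    and f_bilinear: "bilinear_on s2 s2 s1 V V G f"
    and brV_bilinear: "bilinear_on s2 s2 s2 V V V brV"

definition unified_bracket ::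
    "('b \<Rightarrow> 'b \<Rightarrow> 'b) \<Rightarrow> ('c \<Rightarrow> 'b \<Rightarrow> 'c) \<Rightarrow> ('c \<Rightarrow> 'b \<Rightarrow> 'b) \<Rightarrow> ('c \<Rightarrow> 'c \<Rightarrow> 'b) \<Rightarrow> ('c \<Rightarrow> 'c \<Rightarrow> 'c) \<Rightarrow>
     'b::ab_group_add \<times> 'c::ab_group_add \<Rightarrow> 'b \<times> 'c \<Rightarrow> 'b \<times> 'c"
  where "unified_bracket brG ract lact f brV = (\<lambda>(g, x) (h, y).
    (brG g h + lact x h - lact y g + f x y,
     brV x y + ract x h - ract y g))"

locale lie_extending_structure = extending_datum +
  assumes unified_product_lie_algebra:
    "lie_algebra_on (module_prod.scale s1 s2) (G \<times> V) (unified_bracket brG ract lact f brV)"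

definition stabilizes ::
    "'b set \<Rightarrow> ('b \<times> 'c::zero \<Rightarrow> 'b) \<Rightarrow> bool"
  where "stabilizes G \<phi> \<longleftrightarrow> (\<forall>g\<in>G. \<phi> (g, 0) = g)"

definition co_stabilizes ::
    "'b::ab_group_add set \<Rightarrow> 'b set \<Rightarrow> ('b \<times> 'b \<Rightarrow> 'b) \<Rightarrow> bool"
  where "co_stabilizes G V \<phi> \<longleftrightarrow>
    (\<forall>g\<in>G. \<forall>x\<in>V. projection_along G V (\<phi> (g, x)) = x)"

end

theory Submission
  imports Defs
begin

text \<open>
  A complement of \<open>\<gg>\<close> in \<open>E\<close> is the same as a linear retraction \<open>p : E \<rightarrow> \<gg>\<close>, that is, a linear map
  with \<open>p g = g\<close> on \<open>\<gg>\<close>: the complement is \<open>V = ker p\<close>, and \<open>e = p e + (e - p e)\<close> is the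
  decomposition of \<open>e\<close>. Such a retraction exists over every field by extending a basis. The map
  \<open>\<phi>(g, x) = g + x\<close> is then a linear bijection \<open>\<gg> \<times> V \<rightarrow> E\<close> that stabilizes \<open>\<gg>\<close> and co-stabilizes
  \<open>V\<close>, so all that remains is to choose the extending datum that makes the unified bracket the pullback of
  \<open>[-,-]\<close> along \<open>\<phi>\<close>. By bilinearity and skew-symmetry
  \<open>[g + x, h + y] = [g, h] + [x, h] - [y, g] + [x, y]\<close>,
  in which \<open>[g, h]\<close> lies in \<open>\<gg>\<close>. Splitting the other three brackets into their components forces
  \<open>x \<triangleright> h = p [x, h]\<close>, \<open>x \<triangleleft> h = [x, h] - p [x, h]\<close>,
  \<open>f(x, y) = p [x, y]\<close> and \<open>{x, y} = [x, y] - p [x, y]\<close>.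

  The Lie algebra axioms for the unified bracket (in particular the Jacobi identity) require no
  computation with the four maps: they pull back along the injective map \<open>\<phi>\<close>, by the
  lemma \<open>lie_algebra_on_pullback\<close>.
\<close>

section \<open>Lie brackets on subspaces\<close>

text \<open>
  Both sides of each axiom for the pulled back bracket have the same image under the injective map, by the
  same axiom in the target.
\<close>

lemma lie_algebra_on_pullback:
  assumes "lie_algebra_on s2 M br2" and "vector_space s1" and "module.subspace s1 L"
    and lin: "linear_on s1 s2 L M \<phi>" and inj: "inj_on \<phi> L"
    and closed: "\<And>x y. x \<in> L \<Longrightarrow> y \<in> L \<Longrightarrow> br1 x y \<in> L"
    and hom: "\<And>x y. x \<in> L \<Longrightarrow> y \<in> L \<Longrightarrow> \<phi> (br1 x y) = br2 (\<phi> x) (\<phi> y)"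
  shows "lie_algebra_on s1 L br1"
proof -
  interpret M: lie_algebra_on s2 M br2 by fact
  interpret L: vector_space s1 by fact
  note sub = \<open>L.subspace L\<close>
  note L_add = L.subspace_add[OF sub] and L_scale = L.subspace_scale[OF sub]
    and L_zero = L.subspace_0[OF sub]
  have \<phi>_add: "\<phi> (x + y) = \<phi> x + \<phi> y" if "x \<in> L" "y \<in> L" for x y
    using lin that by (auto simp: linear_on_def)
  have \<phi>_M: "\<phi> x \<in> M" and \<phi>_scale: "\<phi> (s1 c x) = s2 c (\<phi> x)" if "x \<in> L" for x c
    using lin that by (auto simp: linear_on_def)
  have \<phi>_zero: "\<phi> 0 = 0"
    using \<phi>_add[of 0 0] L_zero by simp
  have br2_add: "br2 (x + y) z = br2 x z + br2 y z" "br2 z (x + y) = br2 z x + br2 z y"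
    if "x \<in> M" "y \<in> M" "z \<in> M" for x y z
    using M.bracket_bilinear that by (auto simp: bilinear_on_def linear_on_def)
  have br2_scale: "br2 (s2 c x) z = s2 c (br2 x z)" "br2 z (s2 c x) = s2 c (br2 z x)"
    if "x \<in> M" "z \<in> M" for x z c
    using M.bracket_bilinear that by (auto simp: bilinear_on_def linear_on_def)
  have eqI: "x = y" if "\<phi> x = \<phi> y" "x \<in> L" "y \<in> L" for x y
    using inj that by (auto dest: inj_onD)
  show ?thesis
  proof
    show "L.subspace L" by fact
    show "bilinear_on s1 s1 s1 L L L br1"
      unfolding bilinear_on_def linear_on_def
      by (auto intro!: eqI simp: closed hom br2_add br2_scale \<phi>_M \<phi>_add \<phi>_scale L_add L_scale)
  next
    fix x assume "x \<in> L"
    then show "br1 x x = 0"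
      by (intro eqI) (auto simp: closed hom \<phi>_M \<phi>_zero M.bracket_self L_zero)
  next
    fix x y z assume "x \<in> L" "y \<in> L" "z \<in> L"
    then show "br1 x (br1 y z) + br1 y (br1 z x) + br1 z (br1 x y) = 0"
      by (intro eqI) (auto simp: closed hom \<phi>_M \<phi>_add \<phi>_zero M.jacobi L_add L_zero)
  qed
qed

lemma (in lie_algebra_on) bracket_skew:
  assumes "x \<in> L" "y \<in> L"
  shows "br y x = - br x y"
proof -
  have "x + y \<in> L" using assms carrier_subspace by (simp add: subspace_add)
  then have "br (x + y) (x + y) = 0" by (rule bracket_self)
  moreover have "br (x + y) (x + y) = br x x + br x y + (br y x + br y y)"
    using bracket_bilinear assms \<open>x + y \<in> L\<close> by (auto simp: bilinear_on_def linear_on_def algebra_simps)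
  ultimately have "br y x + br x y = 0"
    using assms by (simp add: bracket_self add.commute)
  then show ?thesis by (simp add: add_eq_0_iff2)
qed

section \<open>Retractions onto a Lie subalgebra\<close>

lemma (in vector_space) linear_retraction_onto_subspace_exists:
  assumes "subspace G"
  obtains p where "Vector_Spaces.linear scale scale p" "range p \<subseteq> G" "\<And>g. g \<in> G \<Longrightarrow> p g = g"
proof -
  interpret vector_space_pair scale scale by unfold_locales
  show thesis
    using linear_exists_left_inverse_on[OF linear_ident assms] that by auto
qed

locale lie_subalgebra_retraction =
  E: lie_algebra_on s UNIV br + p: Vector_Spaces.linear s s p
  for s :: "'k::field \<Rightarrow> 'e::ab_group_add \<Rightarrow> 'e" and br :: "'e \<Rightarrow> 'e \<Rightarrow> 'e" and p :: "'e \<Rightarrow> 'e" +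
  fixes G :: "'e set" and brG :: "'e \<Rightarrow> 'e \<Rightarrow> 'e"
  assumes subalgebra: "lie_subalgebra s G brG UNIV br"
    and p_in: "p e \<in> G"
    and p_id: "g \<in> G \<Longrightarrow> p g = g"
begin

sublocale G: lie_algebra_on s G brG
  using subalgebra by (simp add: lie_subalgebra_def)

sublocale prod: vector_space_prod s s
  by unfold_locales

definition V :: "'e set" where "V = {x. p x = 0}"
definition ract :: "'e \<Rightarrow> 'e \<Rightarrow> 'e" where "ract x g = br x g - p (br x g)"
definition lact :: "'e \<Rightarrow> 'e \<Rightarrow> 'e" where "lact x g = p (br x g)"
definition cocycle :: "'e \<Rightarrow> 'e \<Rightarrow> 'e" where "cocycle x y = p (br x y)"
definition brV :: "'e \<Rightarrow> 'e \<Rightarrow> 'e" where "brV x y = br x y - p (br x y)"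
definition \<phi> :: "'e \<times> 'e \<Rightarrow> 'e" where "\<phi> = (\<lambda>(g, x). g + x)"

abbreviation unified :: "'e \<times> 'e \<Rightarrow> 'e \<times> 'e \<Rightarrow> 'e \<times> 'e"
  where "unified \<equiv> unified_bracket brG ract lact cocycle brV"

lemmas datum_defs = ract_def lact_def cocycle_def brV_def

lemma bracket_linear:
  "br (x + y) z = br x z + br y z" "br z (x + y) = br z x + br z y"
  "br (s c x) z = s c (br x z)" "br z (s c x) = s c (br z x)"
  using E.bracket_bilinear by (auto simp: bilinear_on_def linear_on_def)

lemma complement_part_in_V: "e - p e \<in> V"
  by (simp add: V_def p.diff p_id p_in)

lemma subspace_V: "E.subspace V"
  unfolding V_def by (rule p.subspace_kernel)

lemma is_complement_V: "is_complement s G V"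
  unfolding is_complement_def
proof (intro conjI)
  show "E.subspace V" by (rule subspace_V)
  have "e \<in> {g + v | g v. g \<in> G \<and> v \<in> V}" for e
    using p_in[of e] complement_part_in_V[of e] by force
  then show "{g + v | g v. g \<in> G \<and> v \<in> V} = UNIV" by blast
  show "V \<inter> G = {0}"
    using E.subspace_0[OF G.carrier_subspace] p_id by (auto simp: V_def)
qed

lemma p_sum: "g \<in> G \<Longrightarrow> x \<in> V \<Longrightarrow> p (g + x) = g"
  by (simp add: p.add p_id V_def)

lemma projection_along_sum:
  assumes "g \<in> G" "x \<in> V"
  shows "projection_along G V (g + x) = x"
  unfolding projection_along_def
proof (rule the_equality)
  show "x \<in> V \<and> (\<exists>g'\<in>G. g + x = g' + x)" using assms by blast
next
  fix v assume "v \<in> V \<and> (\<exists>g'\<in>G. g + x = g' + v)"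
  then show "v = x" using assms p_sum by (metis add_left_cancel)
qed

lemma extending_datum: "extending_datum s G brG s V ract lact cocycle brV"
proof
  show "E.subspace V" by (rule subspace_V)
qed (auto simp: bilinear_on_def linear_on_def datum_defs bracket_linear p.add p.scale p_in
       complement_part_in_V E.scale_right_diff_distrib)

lemma linear_on_\<phi>: "linear_on prod.scale s (G \<times> V) UNIV \<phi>"
  by (auto simp: linear_on_def \<phi>_def prod.scale_prod E.scale_right_distrib)

lemma bij_betw_\<phi>: "bij_betw \<phi> (G \<times> V) UNIV"
proof (rule bij_betw_byWitness[where f' = "\<lambda>e. (p e, e - p e)"])
  show "\<forall>a\<in>G \<times> V. (p (\<phi> a), \<phi> a - p (\<phi> a)) = a"
    by (auto simp: \<phi>_def p_sum)
qed (auto simp: \<phi>_def p_in complement_part_in_V)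

lemma unified_closed:
  assumes "a \<in> G \<times> V" "b \<in> G \<times> V"
  shows "unified a b \<in> G \<times> V"
proof -
  have "brG g h \<in> G" if "g \<in> G" "h \<in> G" for g h
    using G.bracket_bilinear that by (auto simp: bilinear_on_def linear_on_def)
  moreover have "lact x g \<in> G" "cocycle x y \<in> G" "brV x y \<in> V" "ract x g \<in> V" for x y g
    by (auto simp: datum_defs p_in complement_part_in_V)
  ultimately show ?thesis
    using assms G.carrier_subspace subspace_V
    by (auto simp: unified_bracket_def intro!: E.subspace_add E.subspace_diff)
qed

text \<open>
  Recombining the components \<open>p z\<close> and \<open>z - p z\<close> of each mixed bracket \<open>z\<close> leaves the expansion of
  \<open>[g + x, h + y]\<close> in which \<open>[g, y]\<close> is written as \<open>-[y, g]\<close>.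
\<close>

lemma \<phi>_unified:
  assumes "a \<in> G \<times> V" "b \<in> G \<times> V"
  shows "\<phi> (unified a b) = br (\<phi> a) (\<phi> b)"
proof -
  obtain g x h y where ab: "a = (g, x)" "b = (h, y)" and "g \<in> G" "h \<in> G"
    using assms by blast
  then have "brG g h = br g h" using subalgebra by (simp add: lie_subalgebra_def)
  then show ?thesis
    using E.bracket_skew[of y g]
    by (simp add: ab \<phi>_def unified_bracket_def datum_defs bracket_linear)
qed

lemma unified_product_lie_algebra: "lie_algebra_on prod.scale (G \<times> V) unified"
proof (rule lie_algebra_on_pullback)
  show "lie_algebra_on s UNIV br" by (rule E.lie_algebra_on_axioms)
  show "vector_space prod.scale" by (rule prod.p.vector_space_axioms)
  show "prod.p.subspace (G \<times> V)"
    by (rule prod.subspace_Times[OF G.carrier_subspace subspace_V])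
  show "linear_on prod.scale s (G \<times> V) UNIV \<phi>" by (rule linear_on_\<phi>)
  show "inj_on \<phi> (G \<times> V)" using bij_betw_\<phi> by (rule bij_betw_imp_inj_on)
qed (rule unified_closed \<phi>_unified; assumption)+

lemma lie_extending_structure: "lie_extending_structure s G brG s V ract lact cocycle brV"
  using extending_datum unified_product_lie_algebra
  by (simp add: lie_extending_structure_def lie_extending_structure_axioms_def)

lemma lie_algebra_iso_\<phi>: "lie_algebra_iso prod.scale (G \<times> V) unified s UNIV br \<phi>"
  unfolding lie_algebra_iso_def using linear_on_\<phi> bij_betw_\<phi> \<phi>_unified by blast

lemma stabilizes_\<phi>: "stabilizes G \<phi>"
  by (simp add: stabilizes_def \<phi>_def)

lemma co_stabilizes_\<phi>: "co_stabilizes G V \<phi>"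
  by (simp add: co_stabilizes_def \<phi>_def projection_along_sum)

end

section \<open>Extensions of a Lie algebra are unified products\<close>

theorem theorem2p4:
  fixes s :: "'k::field \<Rightarrow> 'e::ab_group_add \<Rightarrow> 'e"
    and G :: "'e set" and brG brE :: "'e \<Rightarrow> 'e \<Rightarrow> 'e"
  assumes "vector_space s"
    and "lie_algebra_on s G brG"
    and "G \<noteq> {0}"
    and "lie_algebra_on s UNIV brE"
    and "lie_subalgebra s G brG UNIV brE"
  shows "\<exists>V ract lact f brV \<phi>.
    is_complement s G V \<and>
    lie_extending_structure s G brG s V ract lact f brV \<and>
    lie_algebra_iso
      (module_prod.scale s s) (G \<times> V) (unified_bracket brG ract lact f brV)
      s UNIV brE \<phi> \<and>
    stabilizes G \<phi> \<and> co_stabilizes G V \<phi>"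
proof -
  interpret G: lie_algebra_on s G brG by fact
  obtain p where p: "Vector_Spaces.linear s s p" "range p \<subseteq> G" "\<And>g. g \<in> G \<Longrightarrow> p g = g"
    using G.linear_retraction_onto_subspace_exists[OF G.carrier_subspace] by blast
  interpret lie_subalgebra_retraction s brE p G brG
    using assms(4,5) p
    by (auto simp: lie_subalgebra_retraction_def lie_subalgebra_retraction_axioms_def)
  show ?thesis
    using is_complement_V lie_extending_structure lie_algebra_iso_\<phi> stabilizes_\<phi> co_stabilizes_\<phi>
    by blast
qed

end
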